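(* Let $Q$ be a process on $A^{\mathbb{Z}}$ and $\Theta\subseteq\mathcal{P}_{\mathrm{stat}}(A^{\mathbb{Z}})$. Assume that for each $P\in\Theta$ and $\gamma_P$-almost every $W$ the relative entropy rate $h(W,Q)$ exists and $\bar\beta_\varepsilon(W,Q)\le-h(W,Q)$ for all $\varepsilon\in(0,1)$. Then $\underline{h}(P,Q)\in[0,+\infty]$ exists for all $P\in\Theta$, and for every $\Omega\subseteq\Theta$ and every $\eta>0$ there are subsets $M_n\subseteq A^n$ with $\lim_nP^{(n)}(M_n)=1$ for all $P\in\Omega$, and $\limsup_n\frac1n\log Q^{(n)}(M_n)\le-\underline{h}(\Omega,Q)+\eta$ if $\underline{h}(\Omega,Q)<\infty$, resp. $\le -1/\eta$ if $\underline{h}(\Omega,Q)=\infty$. Moreover every sequence $\tilde M_n\subseteq A^n$ with $\lim_nP^{(n)}(\tilde M_n)=1$ for all $P\in\Omega$ satisfies $\liminf_n\frac1n\log Q^{(n)}(\tilde M_n)\ge-\underline{h}(\Omega,Q)$.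
   Context: $A$ finite set; processes are probability measures on $A^{\mathbb{Z}}$ (cylinder $\sigma$-field); $P^{(n)}$ is the marginal on coordinates $\{0,\dots,n-1\}$. $\mathcal{P}_{\mathrm{stat}}(A^{\mathbb{Z}})$ is the set of shift-invariant processes; each $P$ in it has an ergodic decomposition $P=\int W\,\gamma_P(dW)$ over ergodic processes $W$. $h(W,Q)=\lim_n\frac1nH(W^{(n)},Q^{(n)})$ (when it exists in $[0,\infty]$), $H$ the Kullback–Leibler divergence. $\beta_{\varepsilon,n}(W,Q)=\min\{\log Q^{(n)}(M):M\subseteq A^n,W^{(n)}(M)\ge1-\varepsilon\}$, $\bar\beta_\varepsilon=\limsup_n\frac1n\beta_{\varepsilon,n}$. $\underline{h}(P,Q):=\operatorname{ess\,inf}_{\gamma_P(dW)}h(W,Q)$ and $\underline{h}(\Omega,Q):=\inf_{P\in\Omega}\underline{h}(P,Q)$. *)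

theory Defs
  imports "HOL-Probability.Probability"
begin

definition cyl :: "(int \<Rightarrow> 'a::finite) measure" where
  "cyl = PiM UNIV (\<lambda>_. count_space UNIV)"

definition is_process :: "(int \<Rightarrow> 'a::finite) measure \<Rightarrow> bool" where
  "is_process P \<longleftrightarrow> prob_space P \<and> sets P = sets cyl"

definition shift :: "(int \<Rightarrow> 'a) \<Rightarrow> (int \<Rightarrow> 'a)" where
  "shift x = (\<lambda>i. x (i + 1))"

definition stationary :: "(int \<Rightarrow> 'a::finite) measure \<Rightarrow> bool" where
  "stationary P \<longleftrightarrow> is_process P \<and>
     (\<forall>S \<in> sets cyl. measure P (shift -` S) = measure P S)"

definition ergodic :: "(int \<Rightarrow> 'a::finite) measure \<Rightarrow> bool" where
  "ergodic W \<longleftrightarrow> stationary W \<and>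
     (\<forall>S \<in> sets cyl. shift -` S = S \<longrightarrow> measure W S = 0 \<or> measure W S = 1)"

definition ergodic_decomposition ::
  "(int \<Rightarrow> 'a::finite) measure \<Rightarrow> (int \<Rightarrow> 'a) measure measure \<Rightarrow> bool" where
  "ergodic_decomposition P \<gamma> \<longleftrightarrow> prob_space \<gamma> \<and> sets \<gamma> = sets (prob_algebra cyl) \<and>
     (AE W in \<gamma>. ergodic W) \<and>
     (\<forall>S \<in> sets cyl. measure P S = (\<integral>W. measure W S \<partial>\<gamma>))"

definition words :: "nat \<Rightarrow> 'a list set" where
  "words n = {w. length w = n}"

definition word :: "nat \<Rightarrow> (int \<Rightarrow> 'a) \<Rightarrow> 'a list" where
  "word n x = map (\<lambda>i. x (int i)) [0..<n]"

definition marg :: "(int \<Rightarrow> 'a) measure \<Rightarrow> nat \<Rightarrow> 'a list set \<Rightarrow> real" where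
  "marg P n M = measure P {x \<in> space P. word n x \<in> M}"

definition elog :: "real \<Rightarrow> ereal" where
  "elog t = (if t \<le> 0 then -\<infinity> else ereal (ln t))"

definition KL :: "(int \<Rightarrow> 'a::finite) measure \<Rightarrow> (int \<Rightarrow> 'a) measure \<Rightarrow> nat \<Rightarrow> ereal" where
  "KL W Q n = (\<Sum>w \<in> words n.
      (let p = marg W n {w}; q = marg Q n {w} in
        if p = 0 then 0 else if q = 0 then \<infinity> else ereal (p * ln (p / q))))"

definition rel_rate_exists :: "(int \<Rightarrow> 'a::finite) measure \<Rightarrow> (int \<Rightarrow> 'a) measure \<Rightarrow> bool" where
  "rel_rate_exists W Q \<longleftrightarrow> (\<exists>L. (\<lambda>n. ereal (1 / real n) * KL W Q n) \<longlonglongrightarrow> L)"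

definition rel_rate :: "(int \<Rightarrow> 'a::finite) measure \<Rightarrow> (int \<Rightarrow> 'a) measure \<Rightarrow> ereal" where
  "rel_rate W Q = lim (\<lambda>n. ereal (1 / real n) * KL W Q n)"

definition beta :: "real \<Rightarrow> nat \<Rightarrow> (int \<Rightarrow> 'a::finite) measure \<Rightarrow> (int \<Rightarrow> 'a) measure \<Rightarrow> ereal" where
  "beta \<epsilon> n W Q = Min {elog (marg Q n M) | M. M \<subseteq> words n \<and> marg W n M \<ge> 1 - \<epsilon>}"

definition beta_bar :: "real \<Rightarrow> (int \<Rightarrow> 'a::finite) measure \<Rightarrow> (int \<Rightarrow> 'a) measure \<Rightarrow> ereal" where
  "beta_bar \<epsilon> W Q = limsup (\<lambda>n. ereal (1 / real n) * beta \<epsilon> n W Q)"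

definition ess_inf :: "'b measure \<Rightarrow> ('b \<Rightarrow> ereal) \<Rightarrow> ereal" where
  "ess_inf M f = Sup {c. AE x in M. c \<le> f x}"

definition h_low :: "(int \<Rightarrow> 'a::finite) measure measure \<Rightarrow> (int \<Rightarrow> 'a) measure \<Rightarrow> ereal" where
  "h_low \<gamma>P Q = ess_inf \<gamma>P (\<lambda>W. rel_rate W Q)"

definition h_low_set :: "((int \<Rightarrow> 'a::finite) measure \<Rightarrow> (int \<Rightarrow> 'a) measure measure)
     \<Rightarrow> (int \<Rightarrow> 'a) measure set \<Rightarrow> (int \<Rightarrow> 'a) measure \<Rightarrow> ereal" where
  "h_low_set \<gamma> \<Omega> Q = (INF P \<in> \<Omega>. h_low (\<gamma> P) Q)"

end

theory Submission
  imports Defs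
begin

text \<open>
  Both halves rest on one inequality: if \<open>q(M) \<le> e\<^bsup>-t\<^esup>\<close>, then \<open>t p(M) \<le> D(p \<parallel> q) + 1\<close>.

  There are countably many rational distributions on blocks of finite length. Extend each of them to
  weights on \<open>A\<^sup>n\<close> by independence of consecutive blocks, and let \<open>U\<^sub>n\<close> be a mixture of all these
  weights. If \<open>W\<close> is stationary, its block distribution is approximated in relative entropy by a
  rational one, which costs only a constant factor in the mixture; hence
  \<open>D(W\<^sup>(\<^sup>n\<^sup>) \<parallel> U\<^sub>n) = o(n)\<close>, and the inequality gives \<open>U\<^sub>n \<ge> e\<^bsup>-n\<delta>\<^esup> W\<^sup>(\<^sup>n\<^sup>)\<close> with \<open>W\<close>-probability
  tending to one. The test sets \<open>M\<^sub>n = {w. Q\<^sup>(\<^sup>n\<^sup>) w \<le> e\<^bsup>-nc\<^esup> U\<^sub>n w}\<close> have \<open>Q\<close>-probability at most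
  \<open>e\<^bsup>-nc\<^esup>\<close>. By the assumption on \<open>\<beta>\<close> and a Neyman-Pearson argument they are typical for every
  ergodic component \<open>W\<close> with \<open>h(W,Q) > c\<close>, and dominated convergence over the ergodic decomposition
  makes them typical for every \<open>P \<in> \<Omega>\<close>, even if \<open>\<Omega>\<close> is uncountable.

  Conversely, sets that are typical for \<open>P\<close> are, along a subsequence, typical for almost every
  ergodic component \<open>W\<close> of \<open>P\<close>, and the inequality for \<open>W\<^sup>(\<^sup>n\<^sup>)\<close> and \<open>Q\<^sup>(\<^sup>n\<^sup>)\<close> bounds their decay rate
  by \<open>h(W,Q)\<close>.
\<close>

subsection \<open>Relative entropy on finite sets\<close>

definition rel_entropy :: "'b set \<Rightarrow> ('b \<Rightarrow> real) \<Rightarrow> ('b \<Rightarrow> real) \<Rightarrow> ereal" where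
  "rel_entropy S p q = (\<Sum>x\<in>S. if p x = 0 then 0 else if q x = 0 then \<infinity>
     else ereal (p x * ln (p x / q x)))"

lemma mult_ln_div_ge_tangent:
  fixes a b s :: real
  assumes "0 < a" "0 < b"
  shows "a * s + a - b * exp s \<le> a * ln (a / b)"
proof -
  have "ln (b * exp s / a) \<le> b * exp s / a - 1"
    using assms by (intro ln_le_minus_one) simp
  moreover have "ln (b * exp s / a) = s - ln (a / b)"
    using assms by (simp add: ln_div ln_mult_pos)
  ultimately have "a * (s - ln (a / b)) \<le> a * (b * exp s / a - 1)"
    using assms by (intro mult_left_mono) auto
  then show ?thesis using assms by (simp add: algebra_simps)
qed

lemma rel_entropy_ge_variational:
  fixes p q s :: "'b \<Rightarrow> real"
  assumes "\<And>x. x \<in> S \<Longrightarrow> 0 \<le> p x" "\<And>x. x \<in> S \<Longrightarrow> 0 \<le> q x"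
  shows "ereal (\<Sum>x\<in>S. p x * s x + p x - q x * exp (s x)) \<le> rel_entropy S p q"
  unfolding rel_entropy_def sum_ereal[symmetric]
proof (rule sum_mono)
  fix x assume "x \<in> S"
  then show "ereal (p x * s x + p x - q x * exp (s x))
      \<le> (if p x = 0 then 0 else if q x = 0 then \<infinity> else ereal (p x * ln (p x / q x)))"
    using assms[of x] mult_ln_div_ge_tangent[of "p x" "q x" "s x"] by (auto simp: less_le)
qed

lemma rel_entropy_nonneg:
  assumes "\<And>x. x \<in> S \<Longrightarrow> 0 \<le> p x" "\<And>x. x \<in> S \<Longrightarrow> 0 \<le> q x" "sum q S \<le> sum p S"
  shows "0 \<le> rel_entropy S p q"
  using rel_entropy_ge_variational[of S p q "\<lambda>_. 0"] assms
  by (auto simp: sum_subtractf intro: order_trans[rotated])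

lemma rel_entropy_ge_if_sum_le_exp:
  assumes S: "finite S" "A \<subseteq> S"
    and p: "\<And>x. x \<in> S \<Longrightarrow> 0 \<le> p x" and q: "\<And>x. x \<in> S \<Longrightarrow> 0 \<le> q x" "sum q S \<le> sum p S"
    and small: "sum q A \<le> exp (- t)"
  shows "ereal (sum p A * t - 1) \<le> rel_entropy S p q"
proof -
  let ?s = "\<lambda>x. if x \<in> A then t else 0"
  have restrict: "(\<Sum>x\<in>S. if x \<in> A then f x else 0) = sum f A" for f :: "'a \<Rightarrow> real"
    using S by (simp add: sum.inter_restrict[symmetric] Int_absorb1)
  have "exp t * sum q A \<le> exp t * exp (- t)" using small by (intro mult_left_mono) auto
  then have "exp t * sum q A \<le> 1" by (simp add: mult_exp_exp)
  then have "sum p A * t - 1 \<le> sum p A * t + sum p S - (exp t * sum q A + sum q S)"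
    using q(2) by simp
  also have "\<dots> = (\<Sum>x\<in>S. (if x \<in> A then p x * t else 0) + p x
      - ((if x \<in> A then exp t * q x else 0) + q x))"
    by (simp add: sum.distrib sum_subtractf restrict sum_distrib_left sum_distrib_right)
  also have "\<dots> \<le> (\<Sum>x\<in>S. p x * ?s x + p x - q x * exp (?s x))"
    using q(1) by (intro sum_mono) auto
  finally show ?thesis
    using rel_entropy_ge_variational[of S p q ?s] p q(1) by (auto intro: order_trans[rotated])
qed

lemma rel_entropy_ge_sum_likelihood_ratio:
  assumes S: "finite S" and p: "\<And>x. x \<in> S \<Longrightarrow> 0 \<le> p x" "sum p S = 1"
    and q: "\<And>x. x \<in> S \<Longrightarrow> 0 \<le> q x" "sum q S \<le> 1"
  shows "ereal (sum p {x \<in> S. q x < exp (- t) * p x} * t - 1) \<le> rel_entropy S p q"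
proof (rule rel_entropy_ge_if_sum_le_exp)
  let ?A = "{x \<in> S. q x < exp (- t) * p x}"
  have "sum q ?A \<le> exp (- t) * sum p ?A"
    unfolding sum_distrib_left by (intro sum_mono) auto
  also have "\<dots> \<le> exp (- t) * sum p S"
    using S p(1) by (intro mult_left_mono sum_mono2) auto
  finally show "sum q ?A \<le> exp (- t)" using p(2) by simp
qed (use assms in auto)

lemma rel_entropy_le_if_minorant:
  fixes p q r :: "'b \<Rightarrow> real"
  assumes p: "\<And>x. x \<in> S \<Longrightarrow> 0 \<le> p x" "sum p S = 1"
    and minorant: "0 < c" "\<And>x. x \<in> S \<Longrightarrow> 0 < p x \<Longrightarrow> 0 < r x \<and> c * r x \<le> q x"
  shows "rel_entropy S p q \<le> ereal ((\<Sum>x\<in>S. p x * ln (p x)) - (\<Sum>x\<in>S. p x * ln (r x)) - ln c)"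
proof -
  have "rel_entropy S p q \<le> ereal (\<Sum>x\<in>S. p x * (ln (p x) - ln (r x) - ln c))"
    unfolding rel_entropy_def sum_ereal[symmetric]
  proof (rule sum_mono)
    fix x assume x: "x \<in> S"
    show "(if p x = 0 then 0 else if q x = 0 then \<infinity> else ereal (p x * ln (p x / q x)))
        \<le> ereal (p x * (ln (p x) - ln (r x) - ln c))"
    proof (cases "p x = 0")
      case False
      then have pos: "0 < p x" "0 < r x" and le: "c * r x \<le> q x"
        using p(1)[OF x] minorant(2)[OF x] by (auto simp: less_le)
      then have "0 < c * r x" using minorant(1) by simp
      with le have "ln (c * r x) \<le> ln (q x)" and "0 < q x" by auto
      then show ?thesis using pos minorant(1) by (simp add: ln_divide_pos ln_mult_pos)
    qed simp
  qed
  also have "(\<Sum>x\<in>S. p x * (ln (p x) - ln (r x) - ln c))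
      = (\<Sum>x\<in>S. p x * ln (p x)) - (\<Sum>x\<in>S. p x * ln (r x)) - ln c"
    by (simp add: right_diff_distrib sum_subtractf sum_distrib_right[symmetric] p(2))
  finally show ?thesis .
qed

lemma sum_likelihood_ratio_test_error_le:
  fixes p q u :: "'b \<Rightarrow> real"
  assumes S: "finite S" "M \<subseteq> S" and p: "\<And>x. x \<in> S \<Longrightarrow> 0 \<le> p x" and q: "\<And>x. x \<in> S \<Longrightarrow> 0 \<le> q x"
    and pos: "0 < a" "0 < b"
  shows "sum p {x \<in> S. a * u x < q x}
    \<le> sum p (S - M) + sum p {x \<in> S. u x < b * p x} + sum q M / (a * b)"
proof -
  have restrict: "sum f {x \<in> S. R x} = (\<Sum>x\<in>S. if R x then f x else 0)" for f :: "'b \<Rightarrow> real" and R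
    using S(1) by (rule sum.inter_filter)
  have "p x \<le> q x / (a * b)" if "x \<in> S" "a * u x < q x" "\<not> u x < b * p x" for x
  proof -
    have "a * b * p x \<le> a * u x" using that(3) pos by (simp add: mult.assoc)
    also have "\<dots> < q x" by (rule that(2))
    finally show ?thesis using pos by (simp add: pos_le_divide_eq mult_ac)
  qed
  then have "sum p {x \<in> S. a * u x < q x}
      \<le> (\<Sum>x\<in>S. (if x \<notin> M then p x else 0) + (if u x < b * p x then p x else 0)
            + (if x \<in> M then q x / (a * b) else 0))"
    unfolding restrict using p q pos by (intro sum_mono) auto
  also have "\<dots> = sum p {x \<in> S. x \<notin> M} + sum p {x \<in> S. u x < b * p x}
      + (\<Sum>x | x \<in> S \<and> x \<in> M. q x / (a * b))"
    by (simp add: sum.distrib restrict)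
  also have "{x \<in> S. x \<notin> M} = S - M" by auto
  also have "{x. x \<in> S \<and> x \<in> M} = M" using S(2) by auto
  finally show ?thesis by (simp add: sum_divide_distrib)
qed

subsection \<open>Word marginals\<close>

lemma words_eq_lists: "words n = {w. set w \<subseteq> UNIV \<and> length w = n}"
  by (auto simp: words_def)

lemma finite_words [simp]: "finite (words n :: 'a::finite list set)"
  by (simp only: words_eq_lists finite_lists_length_eq finite)

lemma card_words: "card (words n :: 'a::finite list set) = CARD('a) ^ n"
  by (simp only: words_eq_lists card_lists_length_eq finite)

lemma word_in_words [simp]: "word n x \<in> words n"
  by (simp add: words_def word_def)

lemma space_process: "is_process P \<Longrightarrow> space P = UNIV"
  using sets_eq_imp_space_eq[of P cyl] by (simp add: is_process_def cyl_def space_PiM)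

lemma measurable_word: "word n \<in> cyl \<rightarrow>\<^sub>M count_space (UNIV :: 'a::finite list set)"
proof (rule measurable_count_space_eq2_countable[THEN iffD2], intro conjI ballI)
  fix w :: "'a list"
  have [measurable]: "(\<lambda>x. x i) \<in> (cyl :: (int \<Rightarrow> 'a) measure) \<rightarrow>\<^sub>M count_space UNIV" for i
    unfolding cyl_def by (rule measurable_component_singleton) simp
  have "word n -` {w} \<inter> space cyl = {x \<in> space cyl. length w = n \<and> (\<forall>i<n. x (int i) = w ! i)}"
    by (fastforce simp: word_def intro: nth_equalityI)
  also have "\<dots> \<in> sets (cyl :: (int \<Rightarrow> 'a) measure)" by measurable
  finally show "word n -` {w} \<inter> space cyl \<in> sets (cyl :: (int \<Rightarrow> 'a) measure)" .
qed auto

lemma sets_word: "{x. word n x \<in> M} \<in> sets (cyl :: (int \<Rightarrow> 'a::finite) measure)"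
  using measurable_sets[OF measurable_word, of M n]
  by (simp add: cyl_def space_PiM vimage_def)

abbreviation word_prob :: "(int \<Rightarrow> 'a) measure \<Rightarrow> nat \<Rightarrow> 'a list \<Rightarrow> real" where
  "word_prob P n \<equiv> \<lambda>w. marg P n {w}"

lemma marg_process: "is_process P \<Longrightarrow> marg P n M = measure P {x. word n x \<in> M}"
  by (simp add: marg_def space_process)

lemma marg_nonneg [simp]: "0 \<le> marg P n M"
  by (simp add: marg_def)

lemma marg_le_1: "is_process P \<Longrightarrow> marg P n M \<le> 1"
  by (simp add: marg_def is_process_def prob_space.prob_le_1)

lemma integral_word:
  fixes f :: "'a::finite list \<Rightarrow> real"
  assumes P: "is_process P"
  shows "(\<integral>x. f (word n x) \<partial>P) = (\<Sum>w\<in>words n. word_prob P n w * f w)"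
proof -
  interpret prob_space P using P by (simp add: is_process_def)
  have sets: "{x. word n x = w} \<in> sets P" for w
    using P sets_word[of n "{w}"] by (simp add: is_process_def)
  have "f (word n x) = (\<Sum>w\<in>words n. indicator {x. word n x = w} x * f w)" for x
    by (simp add: indicator_def if_distrib[where f = "\<lambda>c. c * _"] cong: if_cong)
  then have "(\<integral>x. f (word n x) \<partial>P) = (\<integral>x. (\<Sum>w\<in>words n. indicator {x. word n x = w} x * f w) \<partial>P)"
    by (simp only:)
  also have "\<dots> = (\<Sum>w\<in>words n. \<integral>x. indicator {x. word n x = w} x * f w \<partial>P)"
    using sets
    by (intro Bochner_Integration.integral_sum) (simp add: emeasure_finite less_top[symmetric])
  finally show ?thesis using sets P by (simp add: marg_process)
qed

lemma sum_word_prob: "is_process P \<Longrightarrow> (\<Sum>w\<in>words n. word_prob P n w) = 1"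
  using integral_word[of P "\<lambda>_. 1" n] by (simp add: is_process_def prob_space.prob_space)

lemma marg_eq_sum:
  assumes P: "is_process P" and M: "M \<subseteq> words n"
  shows "marg P n M = (\<Sum>w\<in>M. word_prob P n w)"
proof -
  have "marg P n M = (\<integral>x. indicator {x. word n x \<in> M} x \<partial>P)"
    using P sets_word[of n M] by (simp add: marg_process is_process_def)
  also have "\<dots> = (\<integral>x. indicator M (word n x) \<partial>P)"
    by (simp add: indicator_def)
  also have "\<dots> = (\<Sum>w\<in>words n. word_prob P n w * indicator M w)"
    using P by (rule integral_word)
  also have "\<dots> = (\<Sum>w\<in>words n \<inter> M. word_prob P n w)"
    by (simp add: indicator_def sum.inter_restrict if_distrib cong: if_cong)
  finally show ?thesis using M by (simp add: Int_absorb1)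
qed

lemma marg_compl:
  assumes "is_process P" "M \<subseteq> words n"
  shows "marg P n (words n - M) = 1 - marg P n M"
  using assms by (simp only: marg_eq_sum[of P _ n] Diff_subset sum_diff finite_words sum_word_prob)

lemma stationary_imp_process: "stationary P \<Longrightarrow> is_process P"
  by (simp add: stationary_def)

lemma measurable_shift: "shift \<in> cyl \<rightarrow>\<^sub>M (cyl :: (int \<Rightarrow> 'a::finite) measure)"
  unfolding cyl_def shift_def[abs_def] by (rule measurable_PiM_single') auto

lemma distr_shift:
  assumes P: "stationary P"
  shows "distr P P shift = P"
proof (rule measure_eqI)
  have sets: "sets P = sets cyl" and space: "space P = UNIV" and "prob_space P"
    using P space_process by (auto simp: stationary_def is_process_def)
  interpret prob_space P by fact
  have shift: "shift \<in> P \<rightarrow>\<^sub>M P"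
    using measurable_shift by (simp add: measurable_cong_sets[OF sets sets])
  fix S assume S: "S \<in> sets (distr P P shift)"
  then have "emeasure (distr P P shift) S = emeasure P (shift -` S)"
    using shift space by (simp add: emeasure_distr)
  also have "\<dots> = emeasure P S"
    using P S sets by (simp add: emeasure_eq_measure stationary_def)
  finally show "emeasure (distr P P shift) S = emeasure P S" .
qed simp

lemma integral_shift_pow:
  fixes f :: "(int \<Rightarrow> 'a::finite) \<Rightarrow> real"
  assumes P: "stationary P" and f: "f \<in> borel_measurable cyl"
  shows "(\<integral>x. f ((shift ^^ j) x) \<partial>P) = (\<integral>x. f x \<partial>P)"
proof (induction j)
  case (Suc j)
  have sets: "sets P = sets cyl" using P by (simp add: stationary_def is_process_def)
  have "(shift ^^ j) \<in> cyl \<rightarrow>\<^sub>M (cyl :: (int \<Rightarrow> 'a) measure)"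
    by (induction j) (auto intro: measurable_compose[OF _ measurable_shift])
  then have "(\<lambda>x. f ((shift ^^ j) x)) \<in> borel_measurable P"
    using f by (simp add: measurable_cong_sets[OF sets refl])
  moreover have "shift \<in> P \<rightarrow>\<^sub>M P"
    using measurable_shift by (simp add: measurable_cong_sets[OF sets sets])
  ultimately have "(\<integral>x. f ((shift ^^ j) (shift x)) \<partial>P) = (\<integral>x. f ((shift ^^ j) x) \<partial>distr P P shift)"
    by (intro integral_distr[symmetric])
  then show ?case using Suc by (simp add: distr_shift[OF P] funpow_swap1)
qed simp

lemma shift_pow: "(shift ^^ j) x = (\<lambda>i. x (i + int j))"
  by (induction j) (auto simp: shift_def add_ac)

lemma sum_word_prob_subword:
  fixes f :: "'a::finite list \<Rightarrow> real"
  assumes P: "stationary P" and le: "j + k \<le> n"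
  shows "(\<Sum>w\<in>words n. word_prob P n w * f (take k (drop j w))) = (\<Sum>v\<in>words k. word_prob P k v * f v)"
proof -
  have process: "is_process P" using P by (rule stationary_imp_process)
  have "take k (drop j (word n x)) = word k ((shift ^^ j) x)" for x :: "int \<Rightarrow> 'a"
    using le by (auto simp: word_def shift_pow list_eq_iff_nth_eq add_ac)
  then have "(\<Sum>w\<in>words n. word_prob P n w * f (take k (drop j w)))
      = (\<integral>x. f (word k ((shift ^^ j) x)) \<partial>P)"
    by (simp add: integral_word[OF process, of "\<lambda>w. f (take k (drop j w))", symmetric])
  also have "\<dots> = (\<integral>x. f (word k x) \<partial>P)"
    using measurable_word by (intro integral_shift_pow[OF P]) (rule measurable_compose, auto)
  finally show ?thesis by (simp add: integral_word[OF process])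
qed

lemma word_prob_le_subword:
  assumes P: "stationary P" and le: "j + k \<le> n" and w: "w \<in> words n"
  shows "word_prob P n w \<le> word_prob P k (take k (drop j w))"
proof -
  let ?v = "take k (drop j w)"
  have "?v \<in> words k" using le w by (simp add: words_def)
  have "word_prob P n w \<le> (\<Sum>w'\<in>words n. word_prob P n w' * indicator {?v} (take k (drop j w')))"
    using member_le_sum[OF w, of "\<lambda>w'. word_prob P n w' * indicator {?v} (take k (drop j w'))"]
    by simp
  also have "\<dots> = (\<Sum>v\<in>words k. word_prob P k v * indicator {?v} v)"
    by (rule sum_word_prob_subword[OF P le])
  also have "\<dots> = word_prob P k ?v"
    using \<open>?v \<in> words k\<close> by (simp add: indicator_def if_distrib cong: if_cong)
  finally show ?thesis .
qed

subsection \<open>Empirical distributions\<close>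

definition empirical :: "'b list \<Rightarrow> 'b \<Rightarrow> real" where
  "empirical xs v = real (count_list xs v) / real (length xs)"

lemma empirical_nonneg: "0 \<le> empirical xs v"
  by (simp add: empirical_def)

lemma sum_empirical_le:
  assumes "finite S"
  shows "sum (empirical xs) S \<le> 1"
proof -
  have "sum (count_list xs) S \<le> sum (count_list xs) (S \<union> set xs)"
    using assms by (intro sum_mono2) auto
  also have "\<dots> = length xs" using assms by (intro sum_count_set) auto
  finally show ?thesis
    by (simp add: empirical_def sum_divide_distrib[symmetric] divide_le_eq_1 flip: of_nat_sum)
qed

lemma ex_list_count_list_eq:
  assumes "finite S"
  obtains xs where "\<And>v. v \<in> S \<Longrightarrow> count_list xs v = m v" "length xs = sum m S"
proof -
  obtain xs where xs: "mset xs = (\<Sum>v\<in>S. replicate_mset (m v) v)" using ex_mset by blast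
  show thesis
  proof
    show "count_list xs v = m v" if "v \<in> S" for v
      using that assms by (simp add: xs count_sum flip: count_mset)
    show "length xs = sum m S" by (simp add: xs flip: size_mset)
  qed
qed

lemma ex_empirical_ge:
  fixes q :: "'b \<Rightarrow> real"
  assumes S: "finite S" and q: "\<And>v. v \<in> S \<Longrightarrow> 0 \<le> q v" "sum q S = 1" and \<theta>: "0 \<le> \<theta>" "\<theta> < 1"
  obtains xs where "\<And>v. v \<in> S \<Longrightarrow> \<theta> * q v \<le> empirical xs v"
proof -
  define N where "N = \<theta> * card S / (1 - \<theta>) + 1"
  have N: "0 < N" "\<theta> * (N + card S) \<le> N"
  proof -
    have "0 \<le> \<theta> * card S / (1 - \<theta>)" using \<theta> by simp
    then show "0 < N" unfolding N_def by linarith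
    have "N * (1 - \<theta>) = \<theta> * card S + (1 - \<theta>)" using \<theta> by (simp add: N_def distrib_right)
    then show "\<theta> * (N + card S) \<le> N" using \<theta>(2) by (simp add: algebra_simps)
  qed
  define m where "m v = nat \<lceil>N * q v\<rceil>" for v
  have m: "N * q v \<le> m v" "m v \<le> N * q v + 1" if "v \<in> S" for v
  proof -
    have "0 \<le> N * q v" using N(1) q(1)[OF that] by simp
    then show "N * q v \<le> m v" "m v \<le> N * q v + 1" unfolding m_def by linarith+
  qed
  obtain xs where xs: "\<And>v. v \<in> S \<Longrightarrow> count_list xs v = m v" "length xs = sum m S"
    using ex_list_count_list_eq[OF S, of m] by metis
  then have len: "real (length xs) = (\<Sum>v\<in>S. real (m v))" by simp
  have "(\<Sum>v\<in>S. N * q v) \<le> length xs" unfolding len using m(1) by (rule sum_mono)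
  then have "N \<le> length xs" using q(2) by (simp add: sum_distrib_left[symmetric])
  with N(1) have pos: "0 < real (length xs)" by linarith
  have "real (length xs) \<le> (\<Sum>v\<in>S. N * q v + 1)" unfolding len using m(2) by (rule sum_mono)
  also have "\<dots> = N + card S" using q(2) by (simp add: sum.distrib flip: sum_distrib_left)
  finally have "\<theta> * length xs \<le> \<theta> * (N + card S)" using \<theta>(1) by (rule mult_left_mono)
  with N(2) have len_le: "\<theta> * length xs \<le> N" by linarith
  show thesis
  proof
    fix v assume v: "v \<in> S"
    have "\<theta> * length xs * q v \<le> N * q v" using len_le q(1)[OF v] by (rule mult_right_mono)
    also have "\<dots> \<le> count_list xs v" using m(1)[OF v] xs(1)[OF v] by simp
    finally show "\<theta> * q v \<le> empirical xs v"
      using pos by (simp add: empirical_def pos_le_divide_eq mult_ac)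
  qed
qed

subsection \<open>Countable mixtures\<close>

definition mixture :: "('c::countable \<Rightarrow> 'b \<Rightarrow> real) \<Rightarrow> 'b \<Rightarrow> real" where
  "mixture f x = (\<Sum>i. (1/2) ^ Suc i * f (from_nat i) x)"

context
  fixes f :: "'c::countable \<Rightarrow> 'b \<Rightarrow> real" and S :: "'b set"
  assumes finite_S: "finite S" and nonneg: "\<And>c x. x \<in> S \<Longrightarrow> 0 \<le> f c x"
    and sum_le: "\<And>c. sum (f c) S \<le> 1"
begin

lemma summable_mixture:
  assumes "x \<in> S"
  shows "summable (\<lambda>i. (1/2) ^ Suc i * f (from_nat i) x)"
proof (rule summable_comparison_test)
  have "f c x \<le> 1" for c
    using member_le_sum[of x S "f c"] assms finite_S nonneg sum_le[of c] by fastforce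
  then show "\<exists>N. \<forall>i\<ge>N. norm ((1/2) ^ Suc i * f (from_nat i) x) \<le> (1/2) ^ Suc i"
    using nonneg[OF assms] by (simp add: abs_mult)
  show "summable (\<lambda>i. (1/2 :: real) ^ Suc i)"
    using power_half_series by (rule sums_summable)
qed

lemma mixture_nonneg: "x \<in> S \<Longrightarrow> 0 \<le> mixture f x"
  unfolding mixture_def using nonneg by (intro suminf_nonneg summable_mixture) auto

lemma mixture_ge:
  assumes "x \<in> S"
  shows "(1/2) ^ Suc (to_nat c) * f c x \<le> mixture f x"
  unfolding mixture_def
  using sum_le_suminf[OF summable_mixture[OF assms], of "{to_nat c}"] nonneg[OF assms] by simp

lemma sum_mixture_le: "sum (mixture f) S \<le> 1"
proof -
  have "sum (mixture f) S = (\<Sum>i. \<Sum>x\<in>S. (1/2) ^ Suc i * f (from_nat i) x)"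
    unfolding mixture_def by (rule suminf_sum[symmetric]) (rule summable_mixture)
  also have "\<dots> \<le> (\<Sum>i. (1/2) ^ Suc i)"
  proof (rule suminf_le)
    show "(\<Sum>x\<in>S. (1/2) ^ Suc i * f (from_nat i) x) \<le> (1/2) ^ Suc i" for i
      unfolding sum_distrib_left[symmetric] by (intro mult_left_le sum_le) simp
    show "summable (\<lambda>i. \<Sum>x\<in>S. (1/2) ^ Suc i * f (from_nat i) x)"
      by (intro summable_sum summable_mixture)
    show "summable (\<lambda>i. (1/2 :: real) ^ Suc i)"
      using power_half_series by (rule sums_summable)
  qed
  also have "\<dots> = 1" using power_half_series by (rule sums_unique[symmetric])
  finally show ?thesis .
qed

end

subsection \<open>Independent blocks\<close>

definition block :: "nat \<Rightarrow> nat \<Rightarrow> 'a list \<Rightarrow> 'a list" where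
  "block k j w = take k (drop (j * k) w)"

text \<open>The last \<open>n mod k\<close> letters are distributed uniformly.\<close>

definition block_weight :: "nat \<Rightarrow> ('a::finite list \<Rightarrow> real) \<Rightarrow> nat \<Rightarrow> 'a list \<Rightarrow> real" where
  "block_weight k p n w = (\<Prod>j<n div k. p (block k j w)) / real CARD('a) ^ (n mod k)"

lemma block_end_le:
  fixes j k n :: nat
  assumes "j < n div k"
  shows "j * k + k \<le> n"
proof -
  have "Suc j * k \<le> n div k * k" using assms by (intro mult_le_mono1) simp
  also have "\<dots> \<le> n" by simp
  finally show ?thesis by simp
qed

lemma block_in_words: "w \<in> words n \<Longrightarrow> j < n div k \<Longrightarrow> block k j w \<in> words k"
  using block_end_le[of j n k] by (simp add: block_def words_def)

lemma block_weight_nonneg: "(\<And>v. 0 \<le> p v) \<Longrightarrow> 0 \<le> block_weight k p n w"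
  by (auto simp: block_weight_def intro!: divide_nonneg_nonneg prod_nonneg)

lemma block_weight_mono:
  assumes "\<And>v. v \<in> words k \<Longrightarrow> 0 \<le> p v \<and> p v \<le> q v" "w \<in> words n"
  shows "block_weight k p n w \<le> block_weight k q n w"
  unfolding block_weight_def using assms block_in_words[OF assms(2), of _ k]
  by (intro divide_right_mono prod_mono) auto

lemma block_weight_cmult: "block_weight k (\<lambda>v. c * p v) n w = c ^ (n div k) * block_weight k p n w"
  by (simp add: block_weight_def prod.distrib)

lemma block_weight_append:
  assumes "0 < k" "length u = k"
  shows "block_weight k p (k + n) (u @ v) = p u * block_weight k p n v"
proof -
  have "(k + n) div k = Suc (n div k)" using assms by simp
  then show ?thesis
    unfolding block_weight_def block_def by (simp only: prod.lessThan_Suc_shift) (use assms in simp)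
qed

lemma words_add: "words (k + n) = (\<lambda>(u, v). u @ v) ` (words k \<times> words n)"
proof -
  have "w \<in> (\<lambda>(u, v). u @ v) ` (words k \<times> words n)" if "length w = k + n" for w :: "'a list"
    using that by (intro image_eqI[of _ _ "(take k w, drop k w)"]) (auto simp: words_def)
  then show ?thesis by (auto simp: words_def)
qed

lemma sum_block_weight_le:
  fixes p :: "'a::finite list \<Rightarrow> real"
  assumes k: "0 < k" and p: "\<And>v. 0 \<le> p v" "sum p (words k) \<le> 1"
  shows "sum (block_weight k p n) (words n) \<le> 1"
proof (induction n rule: less_induct)
  case (less n)
  show ?case
  proof (cases "n < k")
    case True
    then show ?thesis by (simp add: block_weight_def card_words)
  next
    case False
    then obtain m where n: "n = k + m" using le_Suc_ex by (metis not_less)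
    have inj: "inj_on (\<lambda>(u, v). u @ v) (words k \<times> words m :: ('a list \<times> 'a list) set)"
      by (auto simp: inj_on_def words_def)
    have "sum (block_weight k p n) (words n)
        = (\<Sum>(u, v)\<in>words k \<times> words m. p u * block_weight k p m v)"
      unfolding n words_add sum.reindex[OF inj]
      using k by (intro sum.cong) (auto simp: block_weight_append words_def)
    also have "\<dots> = sum p (words k) * sum (block_weight k p m) (words m)"
      by (simp add: sum.cartesian_product[symmetric] sum_product)
    also have "\<dots> \<le> 1 * 1"
      using less[of m] p k n by (intro mult_mono) (auto intro!: sum_nonneg block_weight_nonneg)
    finally show ?thesis by simp
  qed
qed

subsection \<open>A universal mixture\<close>

text \<open>Lists of words code all rational block distributions by a countable type; \<open>Suc\<close> excludes block
  length \<open>0\<close>.\<close>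

definition empirical_blocks :: "nat \<times> 'a::finite list list \<Rightarrow> nat \<Rightarrow> 'a list \<Rightarrow> real" where
  "empirical_blocks c = block_weight (Suc (fst c)) (empirical (snd c))"

lemma empirical_blocks_nonneg: "0 \<le> empirical_blocks c n w"
  unfolding empirical_blocks_def by (intro block_weight_nonneg empirical_nonneg)

lemma sum_empirical_blocks_le: "sum (empirical_blocks c n) (words n) \<le> 1"
  unfolding empirical_blocks_def
  by (intro sum_block_weight_le empirical_nonneg sum_empirical_le) auto

definition universal_weight :: "nat \<Rightarrow> 'a::finite list \<Rightarrow> real" where
  "universal_weight n = mixture (\<lambda>c. empirical_blocks c n)"

lemma universal_weight_nonneg: "w \<in> words n \<Longrightarrow> 0 \<le> universal_weight n w"
  unfolding universal_weight_def
  by (rule mixture_nonneg[OF finite_words empirical_blocks_nonneg sum_empirical_blocks_le])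

lemma sum_universal_weight_le: "sum (universal_weight n) (words n) \<le> 1"
  unfolding universal_weight_def
  by (rule sum_mixture_le[OF finite_words empirical_blocks_nonneg sum_empirical_blocks_le])

lemma universal_weight_ge_empirical_blocks:
  "w \<in> words n \<Longrightarrow> (1/2) ^ Suc (to_nat c) * empirical_blocks c n w \<le> universal_weight n w"
  unfolding universal_weight_def
  by (rule mixture_ge[OF finite_words empirical_blocks_nonneg sum_empirical_blocks_le])

lemma universal_weight_ge_block_weight:
  fixes p :: "'a::finite list \<Rightarrow> real" and \<delta> :: real
  assumes k: "0 < k" and p: "\<And>v. v \<in> words k \<Longrightarrow> 0 \<le> p v" "sum p (words k) = 1" and \<delta>: "0 < \<delta>"
  obtains C where "0 < C"
    "\<And>n w. w \<in> words n \<Longrightarrow> C * exp (- (n * \<delta>)) * block_weight k p n w \<le> universal_weight n w"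
proof -
  obtain m where m: "k = Suc m" using k gr0_implies_Suc by blast
  obtain xs where xs: "\<And>v. v \<in> words k \<Longrightarrow> exp (- \<delta>) * p v \<le> empirical xs v"
    using ex_empirical_ge[of "words k" p "exp (- \<delta>)"] p \<delta> by auto
  let ?C = "(1/2) ^ Suc (to_nat (m, xs)) :: real"
  show thesis
  proof
    fix n and w :: "'a list" assume w: "w \<in> words n"
    have "real (n div k) * \<delta> \<le> n * \<delta>" using \<delta> by (simp add: div_le_dividend)
    then have "exp (- (n * \<delta>)) \<le> exp (- \<delta>) ^ (n div k)" by (simp flip: exp_of_nat_mult)
    moreover have "0 \<le> block_weight k p n w"
      unfolding block_weight_def using p(1) block_in_words[OF w, of _ k]
      by (intro divide_nonneg_nonneg prod_nonneg) auto
    ultimately have "exp (- (n * \<delta>)) * block_weight k p n w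
        \<le> exp (- \<delta>) ^ (n div k) * block_weight k p n w"
      by (rule mult_right_mono)
    also have "\<dots> = block_weight k (\<lambda>v. exp (- \<delta>) * p v) n w" by (rule block_weight_cmult[symmetric])
    also have "\<dots> \<le> block_weight k (empirical xs) n w"
      using xs p(1) w by (intro block_weight_mono) auto
    finally have "?C * (exp (- (n * \<delta>)) * block_weight k p n w)
        \<le> ?C * block_weight k (empirical xs) n w"
      by (intro mult_left_mono) auto
    also have "\<dots> \<le> universal_weight n w"
      using universal_weight_ge_empirical_blocks[OF w, of "(m, xs)"]
      by (simp add: empirical_blocks_def m)
    finally show "?C * exp (- (n * \<delta>)) * block_weight k p n w \<le> universal_weight n w"
      by (simp only: mult.assoc)
  qed simp
qed

subsection \<open>Redundancy of the universal mixture\<close>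

definition block_entropy :: "(int \<Rightarrow> 'a) measure \<Rightarrow> nat \<Rightarrow> real" where
  "block_entropy P n = - (\<Sum>w\<in>words n. word_prob P n w * ln (word_prob P n w))"

lemma block_entropy_nonneg:
  assumes "is_process P"
  shows "0 \<le> block_entropy P n"
proof -
  have "word_prob P n w * ln (word_prob P n w) \<le> 0" for w
    using marg_nonneg[of P n "{w}"] marg_le_1[OF assms, of n "{w}"]
    by (cases "word_prob P n w = 0") (auto simp: mult_le_0_iff less_le)
  then show ?thesis by (simp add: block_entropy_def sum_nonpos)
qed

text \<open>Taking \<open>k\<close> with \<open>f k / k\<close> close to \<open>inf\<^sub>n f n / n\<close> avoids convergence of \<open>f n / n\<close>.\<close>

lemma ex_div_mult_le_add:
  fixes f :: "nat \<Rightarrow> real" and \<delta> :: real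
  assumes f: "\<And>n. 0 \<le> f n" and \<delta>: "0 < \<delta>"
  obtains k where "0 < k" "\<And>n. real (n div k) * f k \<le> f n + n * \<delta>"
proof -
  define h where "h = (INF m. f (Suc m) / Suc m)"
  have bdd: "bdd_below (range (\<lambda>m. f (Suc m) / Suc m))"
    by (rule bdd_belowI[of _ 0]) (auto simp: f)
  have h_nonneg: "0 \<le> h" unfolding h_def by (rule cINF_greatest) (auto simp: f)
  have h_le: "n * h \<le> f n" for n
  proof (cases n)
    case (Suc m)
    have "h \<le> f (Suc m) / Suc m" unfolding h_def by (rule cINF_lower[OF bdd]) simp
    then show ?thesis using Suc by (simp add: pos_le_divide_eq mult.commute)
  qed (simp add: f)
  have "h < h + \<delta>" using \<delta> by simp
  then obtain m where m: "f (Suc m) / Suc m < h + \<delta>"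
    unfolding h_def by (subst (asm) (1) cINF_less_iff[OF _ bdd]) auto
  show thesis
  proof
    fix n
    have "real (n div Suc m) * f (Suc m) \<le> real (n div Suc m) * (Suc m * (h + \<delta>))"
      using m by (intro mult_left_mono)
        (auto simp: pos_divide_less_eq mult.commute simp del: of_nat_Suc)
    also have "\<dots> = real (n div Suc m * Suc m) * (h + \<delta>)" by (simp only: of_nat_mult mult.assoc)
    also have "\<dots> \<le> n * (h + \<delta>)"
      using h_nonneg \<delta> by (intro mult_right_mono)
        (simp_all only: of_nat_le_iff div_times_less_eq_dividend add_nonneg_nonneg less_imp_le)
    finally show "real (n div Suc m) * f (Suc m) \<le> f n + n * \<delta>"
      using h_le[of n] by (simp add: distrib_left)
  qed simp
qed

lemma word_prob_block_pos:
  assumes "stationary P" "w \<in> words n" "0 < word_prob P n w" "j < n div k"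
  shows "0 < word_prob P k (block k j w)"
  unfolding block_def
  using assms(3) word_prob_le_subword[OF assms(1) block_end_le[OF assms(4)] assms(2)]
  by (rule less_le_trans)

lemma block_weight_word_prob_pos:
  assumes "stationary P" "w \<in> words n" "0 < word_prob P n w"
  shows "0 < block_weight k (word_prob P k) n w"
  unfolding block_weight_def using word_prob_block_pos[OF assms]
  by (intro divide_pos_pos prod_pos) auto

lemma sum_word_prob_ln_block_weight:
  fixes P :: "(int \<Rightarrow> 'a::finite) measure"
  assumes P: "stationary P"
  shows "(\<Sum>w\<in>words n. word_prob P n w * ln (block_weight k (word_prob P k) n w))
    = - (real (n div k) * block_entropy P k) - real (n mod k) * ln CARD('a)"
proof -
  have process: "is_process P" using P by (rule stationary_imp_process)
  have "word_prob P n w * ln (block_weight k (word_prob P k) n w)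
      = (\<Sum>j<n div k. word_prob P n w * ln (word_prob P k (block k j w)))
        - word_prob P n w * (real (n mod k) * ln CARD('a))" if w: "w \<in> words n" for w
  proof (cases "word_prob P n w = 0")
    case False
    then have "0 < word_prob P n w" using marg_nonneg[of P n "{w}"] by linarith
    then have pos: "0 < word_prob P k (block k j w)" if "j < n div k" for j
      using that by (rule word_prob_block_pos[OF P w])
    then have "ln (\<Prod>j<n div k. word_prob P k (block k j w))
        = (\<Sum>j<n div k. ln (word_prob P k (block k j w)))"
      by (intro ln_prod) (simp_all add: less_imp_neq[symmetric])
    moreover have "0 < (\<Prod>j<n div k. word_prob P k (block k j w))"
      using pos by (intro prod_pos) auto
    ultimately have "ln (block_weight k (word_prob P k) n w)
        = (\<Sum>j<n div k. ln (word_prob P k (block k j w))) - real (n mod k) * ln CARD('a)"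
      by (simp add: block_weight_def ln_divide_pos ln_realpow)
    then show ?thesis by (simp add: right_diff_distrib sum_distrib_left)
  qed simp
  then have "(\<Sum>w\<in>words n. word_prob P n w * ln (block_weight k (word_prob P k) n w))
      = (\<Sum>j<n div k. \<Sum>w\<in>words n. word_prob P n w * ln (word_prob P k (block k j w)))
        - real (n mod k) * ln CARD('a)"
    by (simp add: sum_subtractf sum.swap[of _ "{..<n div k}"] sum_distrib_right[symmetric]
        sum_word_prob[OF process])
  also have "(\<Sum>j<n div k. \<Sum>w\<in>words n. word_prob P n w * ln (word_prob P k (block k j w)))
      = (\<Sum>j<n div k. - block_entropy P k)"
    unfolding block_def block_entropy_def
    by (intro sum.cong refl)
      (use sum_word_prob_subword[OF P block_end_le, of _ n k "\<lambda>v. ln (word_prob P k v)"] in auto)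
  finally show ?thesis by simp
qed

lemma rel_entropy_universal_weight_le:
  fixes P :: "(int \<Rightarrow> 'a::finite) measure" and \<delta> :: real
  assumes P: "stationary P" and \<delta>: "0 < \<delta>"
  obtains B where "\<And>n. rel_entropy (words n) (word_prob P n) (universal_weight n) \<le> ereal (B + n * \<delta>)"
proof -
  have process: "is_process P" using P by (rule stationary_imp_process)
  obtain k where k: "0 < k" "\<And>n. real (n div k) * block_entropy P k \<le> block_entropy P n + n * (\<delta> / 2)"
    using ex_div_mult_le_add[of "block_entropy P" "\<delta> / 2"] block_entropy_nonneg[OF process] \<delta> by auto
  obtain C where C: "0 < C" "\<And>n w. w \<in> words n \<Longrightarrow>
      C * exp (- (n * (\<delta> / 2))) * block_weight k (word_prob P k) n w \<le> universal_weight n w"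
    using universal_weight_ge_block_weight[OF k(1), of "word_prob P k" "\<delta> / 2"]
      sum_word_prob[OF process] \<delta> by auto
  show thesis
  proof
    fix n
    have "rel_entropy (words n) (word_prob P n) (universal_weight n)
        \<le> ereal ((\<Sum>w\<in>words n. word_prob P n w * ln (word_prob P n w))
          - (\<Sum>w\<in>words n. word_prob P n w * ln (block_weight k (word_prob P k) n w))
          - ln (C * exp (- (n * (\<delta> / 2)))))"
      using C block_weight_word_prob_pos[OF P] sum_word_prob[OF process]
      by (intro rel_entropy_le_if_minorant) auto
    also have "\<dots> = ereal (real (n div k) * block_entropy P k - block_entropy P n + n * (\<delta> / 2)
        + real (n mod k) * ln CARD('a) - ln C)"
      unfolding sum_word_prob_ln_block_weight[OF P]
      using C(1) by (simp add: block_entropy_def ln_mult_pos)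
    also have "\<dots> \<le> ereal ((k * ln CARD('a) - ln C) + n * \<delta>)"
    proof -
      have "real (n mod k) * ln CARD('a) \<le> k * ln CARD('a)"
        using k(1) by (intro mult_right_mono) (auto simp: less_imp_le)
      with k(2)[of n] show ?thesis by simp
    qed
    finally show "rel_entropy (words n) (word_prob P n) (universal_weight n)
        \<le> ereal ((k * ln CARD('a) - ln C) + n * \<delta>)" .
  qed
qed

definition underweighted_words :: "(int \<Rightarrow> 'a::finite) measure \<Rightarrow> real \<Rightarrow> nat \<Rightarrow> 'a list set" where
  "underweighted_words P \<delta> n =
    {w \<in> words n. universal_weight n w < exp (- (n * \<delta>)) * word_prob P n w}"

lemma underweighted_words_subset_words: "underweighted_words P \<delta> n \<subseteq> words n"
  by (auto simp: underweighted_words_def)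

lemma marg_underweighted_words_tendsto_0:
  assumes P: "stationary P" and \<delta>: "0 < \<delta>"
  shows "(\<lambda>n. marg P n (underweighted_words P \<delta> n)) \<longlonglongrightarrow> 0"
proof (rule tendstoI)
  let ?A = "underweighted_words P \<delta>"
  fix e :: real assume e: "0 < e"
  have process: "is_process P" using P by (rule stationary_imp_process)
  obtain B where B: "\<And>n. rel_entropy (words n) (word_prob P n) (universal_weight n)
      \<le> ereal (B + n * (e * \<delta> / 2))"
    using rel_entropy_universal_weight_le[OF P, of "e * \<delta> / 2"] e \<delta> by auto
  have "\<forall>\<^sub>F n in sequentially. (B + 2) / (e * \<delta> / 2) \<le> real n"
    using filterlim_real_sequentially by (simp add: filterlim_at_top)
  then show "\<forall>\<^sub>F n in sequentially. dist (marg P n (?A n)) 0 < e"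
  proof eventually_elim
    case (elim n)
    then have large: "B + 2 \<le> n * (e * \<delta> / 2)"
      using e \<delta> by (simp add: pos_divide_le_eq)
    have "ereal (marg P n (?A n) * (n * \<delta>) - 1)
        \<le> rel_entropy (words n) (word_prob P n) (universal_weight n)"
      unfolding marg_eq_sum[OF process underweighted_words_subset_words]
      unfolding underweighted_words_def
      by (rule rel_entropy_ge_sum_likelihood_ratio)
        (simp_all add: sum_word_prob[OF process] universal_weight_nonneg sum_universal_weight_le)
    also note B[of n]
    finally have "marg P n (?A n) * (n * \<delta>) - 1 \<le> B + n * (e * \<delta> / 2)"
      by simp
    then have "marg P n (?A n) * (n * \<delta>) < e * (n * \<delta>)"
      using large by argo
    then show ?case using \<delta> by (simp add: mult_less_cancel_right)
  qed
qed

subsection \<open>Universal likelihood-ratio tests\<close>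

lemma elog_rate_le_iff:
  assumes "0 < n"
  shows "ereal (1 / real n) * elog t \<le> ereal (- c) \<longleftrightarrow> t \<le> exp (- (n * c))"
proof (cases "t \<le> 0")
  case False
  then have "t \<le> exp (- (n * c)) \<longleftrightarrow> ln t \<le> - (n * c)"
    by (metis exp_le_cancel_iff exp_ln not_le)
  then show ?thesis using False assms by (simp add: elog_def field_simps)
qed (use assms in \<open>simp add: elog_def order_trans[OF _ exp_ge_zero]\<close>)

lemma beta_attained:
  fixes W Q :: "(int \<Rightarrow> 'a::finite) measure"
  assumes "is_process W" "0 \<le> \<epsilon>"
  obtains M where "M \<subseteq> words n" "1 - \<epsilon> \<le> marg W n M" "beta \<epsilon> n W Q = elog (marg Q n M)"
proof -
  let ?S = "{elog (marg Q n M) | M. M \<subseteq> words n \<and> marg W n M \<ge> 1 - \<epsilon>}"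
  have "?S \<subseteq> (\<lambda>M. elog (marg Q n M)) ` Pow (words n)" by auto
  then have "finite ?S" by (rule finite_subset) simp
  moreover have "marg W n (words n) = 1"
    by (simp only: marg_eq_sum[OF assms(1) subset_refl] sum_word_prob[OF assms(1)])
  then have "elog (marg Q n (words n)) \<in> ?S" using assms(2) by auto
  ultimately have "Min ?S \<in> ?S" by (intro Min_in) auto
  then show ?thesis using that unfolding beta_def by auto
qed

lemma beta_bar_lessD:
  fixes c :: real
  assumes W: "is_process W" and \<epsilon>: "0 \<le> \<epsilon>" and less: "beta_bar \<epsilon> W Q < ereal (- c)"
  shows "\<forall>\<^sub>F n in sequentially.
    \<exists>M \<subseteq> words n. 1 - \<epsilon> \<le> marg W n M \<and> marg Q n M \<le> exp (- (n * c))"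
proof -
  have "\<forall>\<^sub>F n in sequentially. ereal (1 / real n) * beta \<epsilon> n W Q < ereal (- c)"
    using less unfolding beta_bar_def by (rule Limsup_lessD)
  then show ?thesis using eventually_gt_at_top[of 0]
  proof eventually_elim
    case (elim n)
    obtain M where "M \<subseteq> words n" "1 - \<epsilon> \<le> marg W n M" "beta \<epsilon> n W Q = elog (marg Q n M)"
      using W \<epsilon> by (rule beta_attained)
    with elim elog_rate_le_iff[of n "marg Q n M" c] show ?case by (auto simp: less_imp_le)
  qed
qed

definition universal_test :: "(int \<Rightarrow> 'a::finite) measure \<Rightarrow> real \<Rightarrow> nat \<Rightarrow> 'a list set" where
  "universal_test Q c n = {w \<in> words n. word_prob Q n w \<le> exp (- (n * c)) * universal_weight n w}"

lemma universal_test_subset_words: "universal_test Q c n \<subseteq> words n"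
  by (auto simp: universal_test_def)

lemma marg_universal_test_le:
  fixes Q :: "(int \<Rightarrow> 'a::finite) measure"
  assumes Q: "is_process Q"
  shows "marg Q n (universal_test Q c n) \<le> exp (- (n * c))"
proof -
  have "marg Q n (universal_test Q c n) = (\<Sum>w\<in>universal_test Q c n. word_prob Q n w)"
    by (rule marg_eq_sum[OF Q universal_test_subset_words])
  also have "\<dots> \<le> (\<Sum>w\<in>universal_test Q c n. exp (- (n * c)) * universal_weight n w)"
    by (intro sum_mono) (auto simp: universal_test_def)
  also have "\<dots> \<le> (\<Sum>w\<in>words n. exp (- (n * c)) * universal_weight n (w :: 'a list))"
    by (intro sum_mono2) (auto simp: universal_test_def universal_weight_nonneg)
  also have "\<dots> \<le> exp (- (n * c))"
    unfolding sum_distrib_left[symmetric] by (intro mult_left_le sum_universal_weight_le) simp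
  finally show ?thesis .
qed

lemma limsup_universal_test_le:
  assumes "is_process Q"
  shows "limsup (\<lambda>n. ereal (1 / real n) * elog (marg Q n (universal_test Q c n))) \<le> ereal (- c)"
proof (rule Limsup_bounded)
  show "\<forall>\<^sub>F n in sequentially.
      ereal (1 / real n) * elog (marg Q n (universal_test Q c n)) \<le> ereal (- c)"
    using eventually_gt_at_top[of 0]
    by eventually_elim (simp only: elog_rate_le_iff marg_universal_test_le[OF assms])
qed

lemma marg_universal_test_error_le:
  fixes W Q :: "(int \<Rightarrow> 'a::finite) measure"
  assumes W: "is_process W" and Q: "is_process Q" and M: "M \<subseteq> words n"
  shows "1 - marg W n (universal_test Q c n) \<le> 1 - marg W n M
    + marg W n (underweighted_words W \<delta> n)
    + exp (n * (c + \<delta>)) * marg Q n M"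
proof -
  let ?U = "\<lambda>w. exp (- (n * c)) * universal_weight n w"
  have "1 - marg W n (universal_test Q c n) = marg W n (words n - universal_test Q c n)"
    using marg_compl[OF W universal_test_subset_words] by simp
  also have "words n - universal_test Q c n = {w \<in> words n. ?U w < word_prob Q n w}"
    by (auto simp: universal_test_def)
  also have "marg W n \<dots> = sum (word_prob W n) {w \<in> words n. ?U w < word_prob Q n w}"
    by (rule marg_eq_sum[OF W]) auto
  also have "\<dots> \<le> sum (word_prob W n) (words n - M)
      + sum (word_prob W n) {w \<in> words n. universal_weight n w < exp (- (n * \<delta>)) * word_prob W n w}
      + sum (word_prob Q n) M / (exp (- (n * c)) * exp (- (n * \<delta>)))"
    using M by (intro sum_likelihood_ratio_test_error_le) auto
  also have "sum (word_prob W n) (words n - M) = 1 - marg W n M"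
    by (simp only: marg_eq_sum[OF W Diff_subset, symmetric] marg_compl[OF W M])
  also have "sum (word_prob W n)
        {w \<in> words n. universal_weight n w < exp (- (n * \<delta>)) * word_prob W n w}
      = marg W n (underweighted_words W \<delta> n)"
    unfolding marg_eq_sum[OF W underweighted_words_subset_words]
    by (simp only: underweighted_words_def)
  also have "sum (word_prob Q n) M / (exp (- (n * c)) * exp (- (n * \<delta>)))
      = exp (n * (c + \<delta>)) * marg Q n M"
    by (simp add: marg_eq_sum[OF Q M] exp_minus field_simps flip: exp_add)
  finally show ?thesis .
qed

lemma marg_universal_test_tendsto_1:
  fixes W Q :: "(int \<Rightarrow> 'a::finite) measure"
  assumes Q: "is_process Q" and W: "stationary W"
    and beta: "\<And>\<epsilon>. 0 < \<epsilon> \<Longrightarrow> \<epsilon> < 1 \<Longrightarrow> beta_bar \<epsilon> W Q < ereal (- c)"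
  shows "(\<lambda>n. marg W n (universal_test Q c n)) \<longlonglongrightarrow> 1"
proof (rule tendstoI)
  have process: "is_process W" using W by (rule stationary_imp_process)
  fix e :: real assume e: "0 < e"
  define \<epsilon> where "\<epsilon> = min (1/2) (e/3)"
  have \<epsilon>: "0 < \<epsilon>" "\<epsilon> < 1" "\<epsilon> \<le> e / 3" using e by (auto simp: \<epsilon>_def)
  obtain b where b: "beta_bar \<epsilon> W Q < ereal b" "b < - c"
    using ereal_dense2[OF beta[OF \<epsilon>(1,2)]] by auto
  define \<delta> where "\<delta> = (- b - c) / 2"
  have "b = - (c + 2 * \<delta>)" by (simp add: \<delta>_def field_simps)
  with b have \<delta>: "0 < \<delta>" "beta_bar \<epsilon> W Q < ereal (- (c + 2 * \<delta>))" by auto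
  have "(\<lambda>n. exp (- \<delta>) ^ n) \<longlonglongrightarrow> 0" using \<delta>(1) by (intro LIMSEQ_realpow_zero) auto
  then have "\<forall>\<^sub>F n in sequentially. exp (- \<delta>) ^ n < e / 3"
    using e by (intro order_tendstoD) auto
  moreover have "\<forall>\<^sub>F n in sequentially. marg W n (underweighted_words W \<delta> n) < e / 3"
    using marg_underweighted_words_tendsto_0[OF W \<delta>(1)] e by (intro order_tendstoD) auto
  moreover note beta_bar_lessD[OF process less_imp_le[OF \<epsilon>(1)] \<delta>(2)]
  ultimately show "\<forall>\<^sub>F n in sequentially. dist (marg W n (universal_test Q c n)) 1 < e"
  proof eventually_elim
    case (elim n)
    then obtain M where M: "M \<subseteq> words n" "1 - \<epsilon> \<le> marg W n M" "marg Q n M \<le> exp (- (n * (c + 2 * \<delta>)))"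
      by auto
    have "exp (n * (c + \<delta>)) * marg Q n M \<le> exp (n * (c + \<delta>)) * exp (- (n * (c + 2 * \<delta>)))"
      using M(3) by (intro mult_left_mono) auto
    also have "\<dots> = exp (- \<delta>) ^ n"
      by (simp add: mult_exp_exp exp_of_nat_mult[symmetric] algebra_simps)
    finally have "1 - marg W n (universal_test Q c n) < e"
      using marg_universal_test_error_le[OF process Q M(1), of c \<delta>] elim M(2) \<epsilon>(3) by linarith
    then show ?case
      using marg_le_1[OF process, of n "universal_test Q c n"] by (simp add: dist_real_def)
  qed
qed

subsection \<open>Ergodic decompositions\<close>

lemma le_ess_infI: "AE x in M. c \<le> f x \<Longrightarrow> c \<le> ess_inf M f"
  unfolding ess_inf_def by (intro Sup_upper) simp

lemma less_ess_infD:
  assumes "c < ess_inf M f"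
  shows "AE x in M. c < f x"
proof -
  obtain d where "c < d" "AE x in M. d \<le> f x"
    using assms unfolding ess_inf_def less_Sup_iff by auto
  then show ?thesis by (auto elim: eventually_mono)
qed

lemma (in prob_space) AE_subseq_tendsto_1:
  fixes f :: "nat \<Rightarrow> 'a \<Rightarrow> real"
  assumes f: "\<And>n. integrable M (f n)" "\<And>n. AE x in M. f n x \<le> 1"
    and lim: "(\<lambda>n. expectation (f n)) \<longlonglongrightarrow> 1"
  obtains r :: "nat \<Rightarrow> nat" where "strict_mono r" "AE x in M. (\<lambda>n. f (r n) x) \<longlonglongrightarrow> 1"
proof -
  have "expectation (\<lambda>x. norm (1 - f n x)) = 1 - expectation (f n)" for n
  proof -
    have "expectation (\<lambda>x. norm (1 - f n x)) = expectation (\<lambda>x. 1 - f n x)"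
      using f(1) f(2)[of n] by (intro integral_cong_AE) (auto elim: eventually_mono)
    then show ?thesis using f(1) by (simp add: prob_space)
  qed
  moreover have "(\<lambda>n. 1 - expectation (f n)) \<longlonglongrightarrow> 1 - 1"
    by (intro tendsto_diff tendsto_const lim)
  ultimately have "(\<lambda>n. expectation (\<lambda>x. norm (1 - f n x))) \<longlonglongrightarrow> 0" by simp
  moreover have "integrable M (\<lambda>x. 1 - f n x)" for n using f(1) by simp
  ultimately obtain r :: "nat \<Rightarrow> nat"
    where r: "strict_mono r" "AE x in M. (\<lambda>n. 1 - f (r n) x) \<longlonglongrightarrow> 0"
    using tendsto_L1_AE_subseq[of M "\<lambda>n x. 1 - f n x"] by blast
  from r(2) have "AE x in M. (\<lambda>n. f (r n) x) \<longlonglongrightarrow> 1"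
  proof eventually_elim
    case (elim x)
    from tendsto_diff[OF tendsto_const[of 1] this] show ?case by simp
  qed
  with r(1) show thesis by (rule that)
qed

lemma ergodic_decomposition_process:
  assumes "ergodic_decomposition P \<gamma>" "W \<in> space \<gamma>"
  shows "is_process W"
  using assms sets_eq_imp_space_eq[of \<gamma> "prob_algebra cyl"]
  by (auto simp: ergodic_decomposition_def space_prob_algebra is_process_def)

lemma ergodic_decomposition_AE_stationary:
  assumes "ergodic_decomposition P \<gamma>"
  shows "AE W in \<gamma>. stationary W"
  using assms by (auto simp: ergodic_decomposition_def ergodic_def elim: eventually_mono)

lemma
  assumes dec: "ergodic_decomposition P \<gamma>" and P: "is_process P"
  shows integrable_marg: "integrable \<gamma> (\<lambda>W. marg W n M)"
    and integral_marg: "(\<integral>W. marg W n M \<partial>\<gamma>) = marg P n M"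
proof -
  interpret prob_space \<gamma> using dec by (simp add: ergodic_decomposition_def)
  have eq: "marg W n M = measure W {x. word n x \<in> M}" if "W \<in> space \<gamma>" for W
    using ergodic_decomposition_process[OF dec that] by (rule marg_process)
  have "(\<lambda>W. measure W {x. word n x \<in> M}) \<in> borel_measurable \<gamma>"
    using dec measurable_measure_prob_algebra[OF sets_word[of n M]]
    by (simp add: ergodic_decomposition_def cong: measurable_cong_sets)
  then have "(\<lambda>W. marg W n M) \<in> borel_measurable \<gamma>" using eq by (simp cong: measurable_cong)
  then show "integrable \<gamma> (\<lambda>W. marg W n M)"
    using marg_le_1[OF ergodic_decomposition_process[OF dec]]
    by (intro integrable_const_bound[where B = 1]) auto
  show "(\<integral>W. marg W n M \<partial>\<gamma>) = marg P n M"
    using dec eq sets_word[of n M] P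
    by (simp add: ergodic_decomposition_def marg_process cong: Bochner_Integration.integral_cong)
qed

lemma marg_tendsto_1_if_AE:
  assumes dec: "ergodic_decomposition P \<gamma>" and P: "is_process P"
    and lim: "AE W in \<gamma>. (\<lambda>n. marg W n (M n)) \<longlonglongrightarrow> 1"
  shows "(\<lambda>n. marg P n (M n)) \<longlonglongrightarrow> 1"
proof -
  interpret prob_space \<gamma> using dec by (simp add: ergodic_decomposition_def)
  have "(\<lambda>n. \<integral>W. marg W n (M n) \<partial>\<gamma>) \<longlonglongrightarrow> (\<integral>W. 1 \<partial>\<gamma>)"
    using integrable_marg[OF dec P] lim marg_le_1[OF ergodic_decomposition_process[OF dec]]
    by (intro integral_dominated_convergence[where w = "\<lambda>_. 1"]) auto
  then show ?thesis by (simp add: integral_marg[OF dec P] prob_space)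
qed

lemma AE_subseq_marg_tendsto_1:
  assumes dec: "ergodic_decomposition P \<gamma>" and P: "is_process P"
    and lim: "(\<lambda>n. marg P n (M n)) \<longlonglongrightarrow> 1" and r: "strict_mono (r :: nat \<Rightarrow> nat)"
  obtains s :: "nat \<Rightarrow> nat" where "strict_mono s"
    "AE W in \<gamma>. (\<lambda>i. marg W (r (s i)) (M (r (s i)))) \<longlonglongrightarrow> 1"
proof -
  interpret prob_space \<gamma> using dec by (simp add: ergodic_decomposition_def)
  have "(\<lambda>i. \<integral>W. marg W (r i) (M (r i)) \<partial>\<gamma>) \<longlonglongrightarrow> 1"
    using LIMSEQ_subseq_LIMSEQ[OF lim r] by (simp add: integral_marg[OF dec P] o_def)
  with AE_subseq_tendsto_1[of "\<lambda>i W. marg W (r i) (M (r i))"] show thesis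
    using integrable_marg[OF dec P] marg_le_1[OF ergodic_decomposition_process[OF dec]] that by auto
qed

lemma marg_universal_test_tendsto_1_if_less_h_low:
  assumes Q: "is_process Q" and P: "is_process P" and dec: "ergodic_decomposition P \<gamma>"
    and beta: "AE W in \<gamma>. \<forall>\<epsilon>. 0 < \<epsilon> \<and> \<epsilon> < 1 \<longrightarrow> beta_bar \<epsilon> W Q \<le> - rel_rate W Q"
    and c: "ereal c < h_low \<gamma> Q"
  shows "(\<lambda>n. marg P n (universal_test Q c n)) \<longlonglongrightarrow> 1"
proof (rule marg_tendsto_1_if_AE[OF dec P])
  have "AE W in \<gamma>. ereal c < rel_rate W Q"
    using c unfolding h_low_def by (rule less_ess_infD)
  with ergodic_decomposition_AE_stationary[OF dec] beta
  show "AE W in \<gamma>. (\<lambda>n. marg W n (universal_test Q c n)) \<longlonglongrightarrow> 1"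
  proof eventually_elim
    case (elim W)
    then have "- rel_rate W Q < ereal (- c)" by (simp flip: uminus_ereal.simps(1))
    with elim show ?case by (intro marg_universal_test_tendsto_1[OF Q]) (auto intro: le_less_trans)
  qed
qed

subsection \<open>The converse bound\<close>

lemma KL_eq_rel_entropy: "KL W Q n = rel_entropy (words n) (word_prob W n) (word_prob Q n)"
  by (simp add: KL_def rel_entropy_def Let_def)

lemma rel_rate_tendsto:
  "rel_rate_exists W Q \<Longrightarrow> (\<lambda>n. ereal (1 / real n) * KL W Q n) \<longlonglongrightarrow> rel_rate W Q"
  unfolding rel_rate_exists_def rel_rate_def using convergent_LIMSEQ_iff convergent_def by blast

lemma rel_rate_nonneg:
  assumes W: "is_process W" and Q: "is_process Q" and rate: "rel_rate_exists W Q"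
  shows "0 \<le> rel_rate W Q"
proof -
  have "0 \<le> KL W Q n" for n
    unfolding KL_eq_rel_entropy
    by (rule rel_entropy_nonneg) (simp_all add: sum_word_prob[OF W] sum_word_prob[OF Q])
  then show ?thesis
    using rel_rate_tendsto[OF rate] by (intro LIMSEQ_le_const) (auto intro!: ereal_0_le_mult)
qed

lemma h_low_nonneg:
  assumes "is_process Q" "ergodic_decomposition P \<gamma>" "AE W in \<gamma>. rel_rate_exists W Q"
  shows "0 \<le> h_low \<gamma> Q"
  unfolding h_low_def
  using ergodic_decomposition_AE_stationary[OF assms(2)] assms(3)
  by (intro le_ess_infI, eventually_elim) (auto simp: stationary_def intro: rel_rate_nonneg assms(1))

lemma rel_rate_ge_if_subseq_decay:
  assumes W: "is_process W" and Q: "is_process Q" and rate: "rel_rate_exists W Q"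
    and M: "\<And>n. M n \<subseteq> words n" and r: "strict_mono (r :: nat \<Rightarrow> nat)"
    and lim: "(\<lambda>i. marg W (r i) (M (r i))) \<longlonglongrightarrow> 1"
    and decay: "\<And>i. ereal (1 / real (r i)) * elog (marg Q (r i) (M (r i))) \<le> ereal (- a)"
  shows "ereal a \<le> rel_rate W Q"
proof (rule tendsto_le[OF sequentially_bot])
  show "(\<lambda>i. ereal (1 / real (r i)) * KL W Q (r i)) \<longlonglongrightarrow> rel_rate W Q"
    using LIMSEQ_subseq_LIMSEQ[OF rel_rate_tendsto[OF rate] r] by (simp add: o_def)
  have "(\<lambda>i. marg W (r i) (M (r i)) * a - 1 / real (r i)) \<longlonglongrightarrow> 1 * a - 0"
    using LIMSEQ_subseq_LIMSEQ[OF lim_const_over_n[of "1 :: real"] r]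
    by (intro tendsto_diff tendsto_mult lim tendsto_const) (simp add: o_def)
  then show "(\<lambda>i. ereal (marg W (r i) (M (r i)) * a - 1 / real (r i))) \<longlonglongrightarrow> ereal a" by simp
  show "\<forall>\<^sub>F i in sequentially. ereal (marg W (r i) (M (r i)) * a - 1 / real (r i))
      \<le> ereal (1 / real (r i)) * KL W Q (r i)"
    using eventually_subseq[OF r eventually_gt_at_top[of 0]]
  proof eventually_elim
    case (elim i)
    let ?n = "r i" let ?M = "M (r i)"
    have "marg Q ?n ?M \<le> exp (- (?n * a))" using decay[of i] elim by (simp only: elog_rate_le_iff)
    then have "ereal (marg W ?n ?M * (?n * a) - 1) \<le> KL W Q ?n"
      unfolding KL_eq_rel_entropy marg_eq_sum[OF W M] marg_eq_sum[OF Q M]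
      by (intro rel_entropy_ge_if_sum_le_exp M)
        (simp_all add: sum_word_prob[OF W] sum_word_prob[OF Q])
    then have "ereal (1 / ?n) * ereal (marg W ?n ?M * (?n * a) - 1) \<le> ereal (1 / ?n) * KL W Q ?n"
      by (intro ereal_mult_left_mono) auto
    then show ?case using elim by (simp add: diff_divide_distrib)
  qed
qed

lemma liminf_elog_marg_ge:
  assumes Q: "is_process Q" and P: "is_process P" and dec: "ergodic_decomposition P \<gamma>"
    and rate: "AE W in \<gamma>. rel_rate_exists W Q"
    and M: "\<And>n. M n \<subseteq> words n" and lim: "(\<lambda>n. marg P n (M n)) \<longlonglongrightarrow> 1"
  shows "- h_low \<gamma> Q \<le> liminf (\<lambda>n. ereal (1 / real n) * elog (marg Q n (M n)))"
proof (rule ccontr)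
  let ?f = "\<lambda>n. ereal (1 / real n) * elog (marg Q n (M n))"
  assume "\<not> - h_low \<gamma> Q \<le> liminf ?f"
  then obtain b where b: "liminf ?f < ereal b" "ereal b < - h_low \<gamma> Q"
    using ereal_dense2 by (meson not_le)
  have "\<not> (\<forall>\<^sub>F n in sequentially. ereal b \<le> ?f n)"
    using Liminf_bounded[of "ereal b" ?f sequentially] b(1) by (auto simp: not_le)
  then obtain r :: "nat \<Rightarrow> nat" where r: "strict_mono r" "\<And>i. \<not> ereal b \<le> ?f (r i)"
    by (blast dest: not_eventually_sequentiallyD)
  obtain s :: "nat \<Rightarrow> nat" where s: "strict_mono s"
      "AE W in \<gamma>. (\<lambda>i. marg W (r (s i)) (M (r (s i)))) \<longlonglongrightarrow> 1"
    using AE_subseq_marg_tendsto_1[OF dec P lim r(1)] .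
  from s(2) ergodic_decomposition_AE_stationary[OF dec] rate have "AE W in \<gamma>. ereal (- b) \<le> rel_rate W Q"
  proof eventually_elim
    case (elim W)
    with r(2) show ?case
      by (intro rel_rate_ge_if_subseq_decay[OF _ Q _ M strict_mono_o[OF r(1) s(1)]])
        (auto simp: stationary_def not_le less_imp_le)
  qed
  then have "ereal (- b) \<le> h_low \<gamma> Q" unfolding h_low_def by (rule le_ess_infI)
  with b(2) show False by (metis ereal_less_uminus_reorder not_le uminus_ereal.simps(1))
qed

subsection \<open>Exponents of families of processes\<close>

lemma ex_rate_threshold:
  fixes h :: ereal and \<eta> :: real
  assumes "0 \<le> h" "0 < \<eta>"
  obtains c where "ereal c < h" "h < \<infinity> \<longrightarrow> ereal (- c) \<le> - h + ereal \<eta>"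
    "h = \<infinity> \<longrightarrow> ereal (- c) \<le> ereal (- 1 / \<eta>)"
proof (cases h)
  case (real x)
  with assms(2) that[of "x - \<eta>"] show thesis by simp
next
  case PInf
  with that[of "1 / \<eta>"] show thesis by simp
qed (use assms(1) in simp)

lemma ex_universal_test:
  fixes Q :: "(int \<Rightarrow> 'a::finite) measure"
  assumes Q: "is_process Q" and P: "\<And>P. P \<in> \<Omega> \<Longrightarrow> is_process P"
    and dec: "\<And>P. P \<in> \<Omega> \<Longrightarrow> ergodic_decomposition P (\<gamma> P)"
    and rate: "\<And>P. P \<in> \<Omega> \<Longrightarrow> AE W in \<gamma> P. rel_rate_exists W Q"
    and beta: "\<And>P. P \<in> \<Omega> \<Longrightarrow>
      AE W in \<gamma> P. \<forall>\<epsilon>. 0 < \<epsilon> \<and> \<epsilon> < 1 \<longrightarrow> beta_bar \<epsilon> W Q \<le> - rel_rate W Q"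
    and \<eta>: "0 < \<eta>"
  shows "\<exists>M :: nat \<Rightarrow> 'a list set. (\<forall>n. M n \<subseteq> words n)
    \<and> (\<forall>P \<in> \<Omega>. (\<lambda>n. marg P n (M n)) \<longlonglongrightarrow> 1)
    \<and> (h_low_set \<gamma> \<Omega> Q < \<infinity> \<longrightarrow>
         limsup (\<lambda>n. ereal (1 / real n) * elog (marg Q n (M n))) \<le> - h_low_set \<gamma> \<Omega> Q + ereal \<eta>)
    \<and> (h_low_set \<gamma> \<Omega> Q = \<infinity> \<longrightarrow>
         limsup (\<lambda>n. ereal (1 / real n) * elog (marg Q n (M n))) \<le> ereal (- 1 / \<eta>))"
proof -
  have "0 \<le> h_low_set \<gamma> \<Omega> Q"
    unfolding h_low_set_def by (intro INF_greatest h_low_nonneg[OF Q dec rate])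
  then obtain c where c: "ereal c < h_low_set \<gamma> \<Omega> Q"
      "h_low_set \<gamma> \<Omega> Q < \<infinity> \<longrightarrow> ereal (- c) \<le> - h_low_set \<gamma> \<Omega> Q + ereal \<eta>"
      "h_low_set \<gamma> \<Omega> Q = \<infinity> \<longrightarrow> ereal (- c) \<le> ereal (- 1 / \<eta>)"
    using \<eta> by (rule ex_rate_threshold)
  have "(\<lambda>n. marg P n (universal_test Q c n)) \<longlonglongrightarrow> 1" if "P \<in> \<Omega>" for P
    using less_INF_D[OF c(1)[unfolded h_low_set_def] that]
    by (rule marg_universal_test_tendsto_1_if_less_h_low[OF Q P dec beta, OF that that that])
  with c(2,3) limsup_universal_test_le[OF Q, of c] universal_test_subset_words[of Q c] show ?thesis
    by (intro exI[of _ "universal_test Q c"]) (auto intro: order_trans)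
qed

theorem mainTheorem6:
  fixes Q :: "(int \<Rightarrow> 'a::finite) measure"
    and \<Theta> :: "(int \<Rightarrow> 'a) measure set"
    and \<gamma> :: "(int \<Rightarrow> 'a) measure \<Rightarrow> (int \<Rightarrow> 'a) measure measure"
  assumes Q: "is_process Q"
    and stat: "\<And>P. P \<in> \<Theta> \<Longrightarrow> stationary P"
    and decomp: "\<And>P. P \<in> \<Theta> \<Longrightarrow> ergodic_decomposition P (\<gamma> P)"
    and hyp: "\<And>P. P \<in> \<Theta> \<Longrightarrow> AE W in \<gamma> P. rel_rate_exists W Q \<and>
               (\<forall>\<epsilon>. 0 < \<epsilon> \<and> \<epsilon> < 1 \<longrightarrow> beta_bar \<epsilon> W Q \<le> - rel_rate W Q)"
  shows "(\<forall>P \<in> \<Theta>. 0 \<le> h_low (\<gamma> P) Q)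
    \<and> (\<forall>\<Omega> \<subseteq> \<Theta>. \<forall>\<eta>::real. \<eta> > 0 \<longrightarrow>
         (\<exists>M :: nat \<Rightarrow> 'a list set. (\<forall>n. M n \<subseteq> words n)
            \<and> (\<forall>P \<in> \<Omega>. (\<lambda>n. marg P n (M n)) \<longlonglongrightarrow> 1)
            \<and> (h_low_set \<gamma> \<Omega> Q < \<infinity> \<longrightarrow>
                 limsup (\<lambda>n. ereal (1 / real n) * elog (marg Q n (M n)))
                   \<le> - h_low_set \<gamma> \<Omega> Q + ereal \<eta>)
            \<and> (h_low_set \<gamma> \<Omega> Q = \<infinity> \<longrightarrow>
                 limsup (\<lambda>n. ereal (1 / real n) * elog (marg Q n (M n))) \<le> ereal (- 1 / \<eta>))))
    \<and> (\<forall>\<Omega> \<subseteq> \<Theta>. \<forall>M' :: nat \<Rightarrow> 'a list set.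
         (\<forall>n. M' n \<subseteq> words n) \<longrightarrow> (\<forall>P \<in> \<Omega>. (\<lambda>n. marg P n (M' n)) \<longlonglongrightarrow> 1) \<longrightarrow>
         liminf (\<lambda>n. ereal (1 / real n) * elog (marg Q n (M' n))) \<ge> - h_low_set \<gamma> \<Omega> Q)"
proof (intro conjI ballI allI impI, goal_cases nonneg achievable converse)
  note process = stat[THEN stationary_imp_process]
  have rate: "AE W in \<gamma> P. rel_rate_exists W Q"
    and beta: "AE W in \<gamma> P. \<forall>\<epsilon>. 0 < \<epsilon> \<and> \<epsilon> < 1 \<longrightarrow> beta_bar \<epsilon> W Q \<le> - rel_rate W Q"
    if "P \<in> \<Theta>" for P using hyp[OF that] by (simp_all add: AE_conj_iff)
  {
    case (nonneg P)
    then show ?case by (intro h_low_nonneg[OF Q decomp rate])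
  next
    case (achievable \<Omega> \<eta>)
    then show ?case by (intro ex_universal_test[OF Q process decomp rate beta]) auto
  next
    case (converse \<Omega> M)
    then have "- h_low (\<gamma> P) Q \<le> liminf (\<lambda>n. ereal (1 / real n) * elog (marg Q n (M n)))"
      if "P \<in> \<Omega>" for P using that by (intro liminf_elog_marg_ge[OF Q process decomp rate]) auto
    then show ?case
      unfolding h_low_set_def ereal_SUP_uminus_eq[symmetric] by (rule SUP_least)
  }
qed

end
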